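(* $\mathfrak{u}\leq\mathfrak{s}_{mm}$ (provable in $\mathsf{ZFC}$).
   Context: For $A,B\subseteq\omega$, $A\subseteq^* B$ means $A\setminus B$ is finite. A family $\mathscr{I}\subseteq[\omega]^\omega$ is ideal independent if whenever $X_0,\dots,X_{n-1},A\in\mathscr{I}$ and $A\subseteq^*\bigcup_{i<n}X_i$, then $X_i=A$ for some $i<n$. A maximal ideal independent family is one maximal under inclusion among ideal independent families, and $\mathfrak{s}_{mm}$ is the least cardinality of a maximal ideal independent family. $\mathfrak{u}$ is the least cardinality of a base of a non-principal ultrafilter on $\omega$ (a base $\mathcal{B}\subseteq\mathscr{U}$ being such that every element of $\mathscr{U}$ almost contains some element of $\mathcal{B}$).
   Formalization: Here 𝔰_mm is the least cardinality of an infinite maximal ideal independent family; with finite families allowed, {ω} would be a maximal ideal independent family, so 𝔰_mm would be 1 and the inequality would fail. *)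

theory Defs
  imports Complex_Main
begin

unbundle cardinal_syntax

definition almost_subset :: "nat set \<Rightarrow> nat set \<Rightarrow> bool"  (infix "\<subseteq>\<^sup>*" 50)
  where "A \<subseteq>\<^sup>* B \<longleftrightarrow> finite (A - B)"

definition ideal_independent :: "nat set set \<Rightarrow> bool"
  where "ideal_independent I \<longleftrightarrow>
    (\<forall>A\<in>I. infinite A) \<and>
    (\<forall>n. \<forall>X :: nat \<Rightarrow> nat set. \<forall>A\<in>I.
       (\<forall>i<n. X i \<in> I) \<and> A \<subseteq>\<^sup>* (\<Union>i<n. X i) \<longrightarrow> (\<exists>i<n. X i = A))"

definition maximal_ideal_independent :: "nat set set \<Rightarrow> bool"
  where "maximal_ideal_independent I \<longleftrightarrow>
    ideal_independent I \<and> (\<forall>J. ideal_independent J \<and> I \<subseteq> J \<longrightarrow> J = I)"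

definition ultrafilter :: "'a filter \<Rightarrow> bool"
  where "ultrafilter U \<longleftrightarrow>
    U \<noteq> bot \<and> (\<forall>P. eventually P U \<or> eventually (\<lambda>x. \<not> P x) U)"

definition nonprincipal :: "'a filter \<Rightarrow> bool"
  where "nonprincipal U \<longleftrightarrow> (\<forall>S. U \<noteq> principal S)"

definition filter_base :: "nat set set \<Rightarrow> nat filter \<Rightarrow> bool"
  where "filter_base B U \<longleftrightarrow>
    (\<forall>X\<in>B. eventually (\<lambda>n. n \<in> X) U) \<and>
    (\<forall>Y. eventually (\<lambda>n. n \<in> Y) U \<longrightarrow> (\<exists>X\<in>B. X \<subseteq>\<^sup>* Y))"

text \<open>The least cardinality of a member of a nonempty collection \<open>S\<close>, as a cardinal order;
  unspecified if \<open>S\<close> is empty.\<close>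

definition least_card :: "'a set set \<Rightarrow> 'a rel"
  where "least_card S = |SOME A. A \<in> S \<and> (\<forall>B\<in>S. |A| \<le>o |B| )|"

lemma least_card_attained:
  assumes "S \<noteq> {}"
  shows "\<exists>A\<in>S. least_card S = |A| \<and> (\<forall>B\<in>S. |A| \<le>o |B| )"
proof -
  have "\<exists>r\<in>card_of ` S. \<forall>r'\<in>card_of ` S. r \<le>o r'"
    using assms by (intro exists_minim_Card_order) (auto simp: card_of_Card_order)
  then have "\<exists>A. A \<in> S \<and> (\<forall>B\<in>S. |A| \<le>o |B| )"
    by blast
  from someI_ex[OF this] show ?thesis
    unfolding least_card_def by blast
qed

definition ultrafilter_number :: "nat set rel"  ("\<uu>")
  where "\<uu> = least_card {B. \<exists>U. ultrafilter U \<and> nonprincipal U \<and> filter_base B U}"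

text \<open>As usual for cardinal characteristics, only infinite families are considered. A finite
  family whose union is cofinite can be maximal ideal independent; for instance, the family
  whose only member is all of \<open>\<omega>\<close> is.\<close>

lemma maximal_ideal_independent_UNIV: "maximal_ideal_independent {UNIV}"
proof -
  have "ideal_independent {UNIV}"
    unfolding ideal_independent_def
  proof (intro conjI allI ballI impI)
    fix n and X :: "nat \<Rightarrow> nat set" and A :: "nat set"
    assume A: "A \<in> {UNIV}" and X: "(\<forall>i<n. X i \<in> {UNIV}) \<and> A \<subseteq>\<^sup>* (\<Union>i<n. X i)"
    have "n \<noteq> 0"
    proof
      assume "n = 0"
      with A X have "finite (UNIV :: nat set)"
        by (simp add: almost_subset_def)
      then show False by simp
    qed
    with A X show "\<exists>i<n. X i = A"
      by (intro exI[of _ 0]) simp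
  qed simp
  moreover have "J = {UNIV}" if J: "ideal_independent J" "{UNIV} \<subseteq> J" for J
  proof -
    have "A = UNIV" if "A \<in> J" for A
    proof -
      note J(1)[unfolded ideal_independent_def, THEN conjunct2,
          THEN spec[of _ "Suc 0"], THEN spec[of _ "\<lambda>_. UNIV"], THEN bspec, OF that]
      moreover have "A \<subseteq>\<^sup>* (\<Union>i<Suc 0. UNIV)"
        unfolding almost_subset_def lessThan_Suc by simp
      moreover have "UNIV \<in> J"
        using J(2) by simp
      ultimately have "\<exists>i<Suc 0. UNIV = A"
        by simp
      then show ?thesis by simp
    qed
    with J show ?thesis by blast
  qed
  ultimately show ?thesis
    unfolding maximal_ideal_independent_def by blast
qed

definition max_ideal_independence_number :: "nat set rel"  ("\<ss>\<^sub>m\<^sub>m")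
  where "\<ss>\<^sub>m\<^sub>m = least_card {I. maximal_ideal_independent I \<and> infinite I}"

end

theory Submission
  imports Defs "HOL-Library.Disjoint_Sets" "HOL-Library.Nat_Bijection" "HOL-Algebra.Free_Abelian_Groups"
begin

text \<open>Let \<open>I\<close> be infinite and maximal ideal independent. For \<open>A \<in> I\<close>, the sets almost covered by
  finitely many members of \<open>I - {A}\<close> form an ideal not containing \<open>A\<close>. If for some \<open>A\<close> there is a
  set positive for this ideal that cannot be split into two positive sets, then the ideal restricted
  to that set is dual to an ultrafilter with a base of size at most \<open>|I|\<close>. Otherwise, split each of
  countably many members \<open>A\<^sub>n\<close> into infinitely many positive pieces. Choosing one piece from each
  \<open>A\<^sub>n - (\<Union>m<n. A\<^sub>m)\<close> along a family of continuum many eventually different functions gives sets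
  \<open>Y\<^sub>x\<close>, and maximality provides for each of them some \<open>A \<in> I\<close> that is contained in \<open>Y\<^sub>x\<close> modulo
  the ideal of \<open>A\<close>. This member is not one of the \<open>A\<^sub>n\<close>, hence it determines \<open>x\<close>, as distinct
  \<open>Y\<^sub>x\<close> and \<open>Y\<^sub>y\<close> meet only inside finitely many \<open>A\<^sub>n\<close>. So \<open>I\<close> has size continuum.\<close>

section \<open>The ideal generated by a family together with the finite sets\<close>

definition in_ideal :: "nat set set \<Rightarrow> nat set \<Rightarrow> bool"
  where "in_ideal K S \<longleftrightarrow> (\<exists>X\<in>Fpow K. S \<subseteq>\<^sup>* \<Union>X)"

lemma in_idealI: "finite X \<Longrightarrow> X \<subseteq> K \<Longrightarrow> S \<subseteq>\<^sup>* \<Union>X \<Longrightarrow> in_ideal K S"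
  by (auto simp: in_ideal_def Fpow_def)

lemma in_idealE:
  assumes "in_ideal K S"
  obtains X where "finite X" "X \<subseteq> K" "S \<subseteq>\<^sup>* \<Union>X"
  using assms by (auto simp: in_ideal_def Fpow_def)

lemma in_ideal_finite: "finite S \<Longrightarrow> in_ideal K S"
  by (rule in_idealI[of "{}"]) (auto simp: almost_subset_def)

lemma in_ideal_Union: "finite X \<Longrightarrow> X \<subseteq> K \<Longrightarrow> in_ideal K (\<Union>X)"
  by (rule in_idealI[of X]) (auto simp: almost_subset_def)

lemma in_ideal_subset:
  assumes "in_ideal K T" "S \<subseteq> T"
  shows "in_ideal K S"
proof -
  obtain X where X: "finite X" "X \<subseteq> K" "T \<subseteq>\<^sup>* \<Union>X"
    using assms(1) by (rule in_idealE)
  have "S - \<Union>X \<subseteq> T - \<Union>X" using assms(2) by blast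
  then have "S \<subseteq>\<^sup>* \<Union>X" using X(3) finite_subset unfolding almost_subset_def by blast
  with X show ?thesis by (blast intro: in_idealI)
qed

lemma in_ideal_mono: "in_ideal K S \<Longrightarrow> K \<subseteq> L \<Longrightarrow> in_ideal L S"
  unfolding in_ideal_def using Fpow_mono by blast

lemma in_ideal_Un:
  assumes "in_ideal K S" "in_ideal K T"
  shows "in_ideal K (S \<union> T)"
proof -
  obtain X where X: "finite X" "X \<subseteq> K" "S \<subseteq>\<^sup>* \<Union>X"
    using assms(1) by (rule in_idealE)
  obtain Y where Y: "finite Y" "Y \<subseteq> K" "T \<subseteq>\<^sup>* \<Union>Y"
    using assms(2) by (rule in_idealE)
  have "S \<union> T - \<Union>(X \<union> Y) \<subseteq> (S - \<Union>X) \<union> (T - \<Union>Y)" by blast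
  then have "S \<union> T \<subseteq>\<^sup>* \<Union>(X \<union> Y)"
    using X(3) Y(3) unfolding almost_subset_def by (meson finite_Un finite_subset)
  with X Y show ?thesis by (intro in_idealI[of "X \<union> Y"]) auto
qed

lemma in_ideal_insert:
  assumes "in_ideal (insert Y K) S"
  shows "in_ideal K (S - Y)"
proof -
  obtain X where X: "finite X" "X \<subseteq> insert Y K" "S \<subseteq>\<^sup>* \<Union>X"
    using assms by (rule in_idealE)
  have "S - Y - \<Union>(X - {Y}) \<subseteq> S - \<Union>X" by blast
  then have "S - Y \<subseteq>\<^sup>* \<Union>(X - {Y})"
    using X(3) finite_subset unfolding almost_subset_def by blast
  with X show ?thesis by (intro in_idealI[of "X - {Y}"]) auto
qed

text \<open>Enumerating a finite subfamily turns covers by sequences into covers by finite sets and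
  back. Infinitude of the members is automatic, as every finite set lies in the ideal.\<close>

lemma ideal_independent_iff: "ideal_independent I \<longleftrightarrow> (\<forall>A\<in>I. \<not> in_ideal (I - {A}) A)"
proof
  assume I: "ideal_independent I"
  show "\<forall>A\<in>I. \<not> in_ideal (I - {A}) A"
  proof (intro ballI notI)
    fix A assume A: "A \<in> I" "in_ideal (I - {A}) A"
    from A(2) obtain X where X: "finite X" "X \<subseteq> I - {A}" "A \<subseteq>\<^sup>* \<Union>X"
      by (rule in_idealE)
    obtain n and f :: "nat \<Rightarrow> nat set" where f: "X = f ` {i. i < n}"
      using finite_imp_nat_seg_image_inj_on[OF X(1)] by blast
    have "(\<forall>i<n. f i \<in> I) \<and> A \<subseteq>\<^sup>* (\<Union>i<n. f i)"
      using X(2,3) by (auto simp: f lessThan_def)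
    then have "\<exists>i<n. f i = A"
      using I A(1) unfolding ideal_independent_def by blast
    then show False using X(2) f by blast
  qed
next
  assume I: "\<forall>A\<in>I. \<not> in_ideal (I - {A}) A"
  have "\<exists>i<n. X i = A" if "A \<in> I" "\<forall>i<n. X i \<in> I" "A \<subseteq>\<^sup>* (\<Union>i<n. X i)"
    for A n and X :: "nat \<Rightarrow> nat set"
  proof (rule ccontr)
    assume "\<not> (\<exists>i<n. X i = A)"
    then have "in_ideal (I - {A}) A"
      using that by (intro in_idealI[of "X ` {..<n}"]) auto
    then show False using I that(1) by blast
  qed
  then show "ideal_independent I"
    unfolding ideal_independent_def using I in_ideal_finite by blast
qed

text \<open>If \<open>Y\<close> is not in \<open>I\<close>, adding it destroys independence. The
  covered member cannot be \<open>Y\<close>, which is positive for \<open>I\<close>, so it is some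
  \<open>B\<close> in \<open>I\<close>, and dropping \<open>Y\<close> from its cover leaves a cover
  of \<open>B - Y\<close>.\<close>

lemma maximal_ideal_independentD:
  assumes "maximal_ideal_independent I" "\<not> in_ideal I Y"
  shows "\<exists>A\<in>I. in_ideal (I - {A}) (A - Y)"
proof (cases "Y \<in> I")
  case True
  then show ?thesis by (intro bexI[of _ Y]) (simp_all add: in_ideal_finite)
next
  case False
  then have "\<not> ideal_independent (insert Y I)"
    using assms(1) unfolding maximal_ideal_independent_def by blast
  then obtain B where B: "B \<in> insert Y I" "in_ideal (insert Y I - {B}) B"
    unfolding ideal_independent_iff by blast
  have "B \<noteq> Y"
    using B(2) assms(2) False in_ideal_mono[of "insert Y I - {B}" B I] by blast
  then have "B \<in> I" "insert Y I - {B} = insert Y (I - {B})"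
    using B(1) by auto
  then show ?thesis using B(2) in_ideal_insert by metis
qed

section \<open>Existence of maximal families\<close>

text \<open>Tukey's lemma: a finite subset of the union of a chain lies in one member of the chain,
  so the union inherits \<open>P\<close> and Zorn's lemma applies.\<close>

lemma finite_character_maximal:
  assumes "P K"
    and mono: "\<And>L M. P M \<Longrightarrow> L \<subseteq> M \<Longrightarrow> P L"
    and fin: "\<And>L. (\<And>F. finite F \<Longrightarrow> F \<subseteq> L \<Longrightarrow> P F) \<Longrightarrow> P L"
  shows "\<exists>M. P M \<and> K \<subseteq> M \<and> (\<forall>L. P L \<and> M \<subseteq> L \<longrightarrow> L = M)"
proof -
  let ?A = "{M. P M \<and> K \<subseteq> M}"
  have "\<exists>M\<in>?A. \<forall>L\<in>?A. M \<subseteq> L \<longrightarrow> L = M"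
  proof (rule subset_Zorn_nonempty)
    show "?A \<noteq> {}" using assms(1) by blast
  next
    fix C assume C: "C \<noteq> {}" "subset.chain ?A C"
    have "P F" if F: "finite F" "F \<subseteq> \<Union>C" for F
    proof -
      obtain M where "M \<in> C" "F \<subseteq> M"
        by (rule finite_subset_Union_chain[OF F C])
      then show ?thesis
        using mono[of M F] C(2) unfolding subset.chain_def by blast
    qed
    then have "P (\<Union>C)" by (rule fin)
    moreover have "K \<subseteq> \<Union>C"
      using C unfolding subset.chain_def by blast
    ultimately show "\<Union>C \<in> ?A" by blast
  qed
  then obtain M where "M \<in> ?A" and max: "\<forall>L\<in>?A. M \<subseteq> L \<longrightarrow> L = M" ..
  then have M: "P M" "K \<subseteq> M" by simp_all
  have "L = M" if "P L" "M \<subseteq> L" for L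
    using bspec[OF max, of L] that M(2) by blast
  then show ?thesis
    using M by blast
qed

lemma ex_infinite_maximal_ideal_independent: "\<exists>I. maximal_ideal_independent I \<and> infinite I"
proof -
  \<comment> \<open>The columns of the pairing function are infinitely many disjoint infinite sets.
    Starting from them keeps the maximal family infinite.\<close>
  define D where "D n = range (\<lambda>k. prod_encode (n, k))" for n
  have disj: "D m \<inter> D n = {}" if "m \<noteq> n" for m n
    using that by (auto simp: D_def)
  have infin: "infinite (D n)" for n
    unfolding D_def by (rule range_inj_infinite) (simp add: inj_on_def)
  have injD: "inj D"
  proof (rule injI)
    fix m n assume "D m = D n"
    then show "m = n" using disj[of m n] infin[of n] by (cases "m = n") auto
  qed
  have "ideal_independent (range D)"
    unfolding ideal_independent_iff
  proof (intro ballI notI)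
    fix A assume A: "A \<in> range D" "in_ideal (range D - {A}) A"
    from A(2) obtain X where X: "finite X" "X \<subseteq> range D - {A}" "A \<subseteq>\<^sup>* \<Union>X"
      by (rule in_idealE)
    obtain n where n: "A = D n" using A(1) by blast
    have "A \<inter> B = {}" if B: "B \<in> X" for B
    proof -
      obtain k where "B = D k" "n \<noteq> k" using B X(2) n by blast
      then show ?thesis using disj n by simp
    qed
    then have "A \<inter> \<Union>X = {}" by blast
    then have "finite A"
      using X(3) unfolding almost_subset_def by (simp add: Diff_triv)
    then show False using infin n by blast
  qed
  then have "\<exists>M. ideal_independent M \<and> range D \<subseteq> M \<and>
    (\<forall>L. ideal_independent L \<and> M \<subseteq> L \<longrightarrow> L = M)"
  proof (rule finite_character_maximal)
    show "ideal_independent L" if "ideal_independent M" "L \<subseteq> M" for L M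
    proof -
      have "L - {A} \<subseteq> M - {A}" for A using that(2) by blast
      then show ?thesis
        using that in_ideal_mono unfolding ideal_independent_iff by (meson subsetD)
    qed
  next
    fix L :: "nat set set"
    assume L: "\<And>F. finite F \<Longrightarrow> F \<subseteq> L \<Longrightarrow> ideal_independent F"
    show "ideal_independent L"
      unfolding ideal_independent_iff
    proof (intro ballI notI)
      fix A assume A: "A \<in> L" "in_ideal (L - {A}) A"
      from A(2) obtain X where X: "finite X" "X \<subseteq> L - {A}" "A \<subseteq>\<^sup>* \<Union>X"
        by (rule in_idealE)
      \<comment> \<open>A failure of independence involves only \<open>A\<close> and a finite cover,
        hence already occurs in a finite subfamily.\<close>
      then have "in_ideal (insert A X - {A}) A"
        by (intro in_idealI[of X]) auto
      moreover have "ideal_independent (insert A X)"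
        using X A(1) by (intro L) auto
      ultimately show False unfolding ideal_independent_iff by blast
    qed
  qed
  then obtain M where M: "maximal_ideal_independent M" "range D \<subseteq> M"
    unfolding maximal_ideal_independent_def by blast
  moreover have "infinite (range D)" using injD by (rule range_inj_infinite)
  ultimately show ?thesis using finite_subset by blast
qed

section \<open>Ultrafilters from unsplittable positive sets\<close>

text \<open>The sets containing \<open>P\<close> modulo the ideal form a filter, proper by
  \<open>pos\<close> and ultra by \<open>unsplit\<close>. It contains all cofinite sets, so it is
  nonprincipal.\<close>

lemma unsplit_positive_ultrafilter_base:
  assumes pos: "\<not> in_ideal K P"
    and unsplit: "\<And>S. in_ideal K (P \<inter> S) \<or> in_ideal K (P - S)"
  shows "\<exists>U. ultrafilter U \<and> nonprincipal U \<and> filter_base ((\<lambda>X. P - \<Union>X) ` Fpow K) U"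
proof -
  define U where "U = Abs_filter (\<lambda>Q. in_ideal K (P - {n. Q n}))"
  have "is_filter (\<lambda>Q. in_ideal K (P - {n. Q n}))"
  proof
    show "in_ideal K (P - {n. True})" by (simp add: in_ideal_finite)
  next
    fix Q R assume "in_ideal K (P - {n. Q n})" "in_ideal K (P - {n. R n})"
    from in_ideal_Un[OF this] show "in_ideal K (P - {n. Q n \<and> R n})"
      by (rule in_ideal_subset) blast
  next
    fix Q R :: "nat \<Rightarrow> bool" assume "\<forall>n. Q n \<longrightarrow> R n" "in_ideal K (P - {n. Q n})"
    then show "in_ideal K (P - {n. R n})" by (blast intro: in_ideal_subset)
  qed
  then have ev: "eventually Q U \<longleftrightarrow> in_ideal K (P - {n. Q n})" for Q
    unfolding U_def by (rule eventually_Abs_filter)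
  have proper: "U \<noteq> bot"
    using pos ev[of "\<lambda>_. False"] by auto
  have "ultrafilter U"
    unfolding ultrafilter_def
  proof (intro conjI allI)
    fix Q :: "nat \<Rightarrow> bool"
    have "P \<inter> {n. Q n} = P - {n. \<not> Q n}" by blast
    then show "eventually Q U \<or> eventually (\<lambda>n. \<not> Q n) U"
      unfolding ev using unsplit[of "{n. Q n}"] by metis
  qed (rule proper)
  moreover have "nonprincipal U"
    unfolding nonprincipal_def
  proof (intro allI notI)
    fix S assume S: "U = principal S"
    then obtain a where a: "a \<in> S"
      using proper by (metis equals0I principal_eq_bot_iff)
    have "P - {n. n \<noteq> a} \<subseteq> {a}" by blast
    then have "in_ideal K (P - {n. n \<noteq> a})"
      using finite_subset by (intro in_ideal_finite) blast
    then have "eventually (\<lambda>n. n \<noteq> a) U" unfolding ev .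
    then show False using a unfolding S eventually_principal by blast
  qed
  moreover have "filter_base ((\<lambda>X. P - \<Union>X) ` Fpow K) U"
    unfolding filter_base_def
  proof (intro conjI ballI allI impI)
    fix Y assume "Y \<in> (\<lambda>X. P - \<Union>X) ` Fpow K"
    then obtain X where X: "finite X" "X \<subseteq> K" "Y = P - \<Union>X"
      by (auto simp: Fpow_def)
    from in_ideal_Union[OF X(1,2)] have "in_ideal K (P - Y)"
      by (rule in_ideal_subset) (auto simp: X(3))
    then show "eventually (\<lambda>n. n \<in> Y) U" unfolding ev by simp
  next
    fix Y assume "eventually (\<lambda>n. n \<in> Y) U"
    then have "in_ideal K (P - Y)" unfolding ev by simp
    then obtain X where X: "X \<in> Fpow K" "P - Y \<subseteq>\<^sup>* \<Union>X"
      unfolding in_ideal_def by blast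
    have "P - Y - \<Union>X = P - \<Union>X - Y" by blast
    then show "\<exists>B\<in>(\<lambda>X. P - \<Union>X) ` Fpow K. B \<subseteq>\<^sup>* Y"
      using X unfolding almost_subset_def by auto
  qed
  ultimately show ?thesis by blast
qed

text \<open>A maximal family generating a proper ideal generates a prime one: a set \<open>S\<close>
  outside the family would make the ideal improper, so its complement already lies in the ideal.
  Thus \<open>UNIV\<close> is unsplittable.\<close>

lemma ex_nonprincipal_ultrafilter_base:
  "\<exists>B U. ultrafilter U \<and> nonprincipal U \<and> filter_base B U"
proof -
  have "\<not> in_ideal {} UNIV"
    by (auto simp: almost_subset_def elim!: in_idealE)
  then have "\<exists>M. \<not> in_ideal M UNIV \<and> {} \<subseteq> M \<and> (\<forall>L. \<not> in_ideal L UNIV \<and> M \<subseteq> L \<longrightarrow> L = M)"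
  proof (rule finite_character_maximal)
    show "\<not> in_ideal L UNIV" if "\<not> in_ideal M UNIV" "L \<subseteq> M" for L M
      using that in_ideal_mono by blast
  next
    fix L assume "\<And>F. finite F \<Longrightarrow> F \<subseteq> L \<Longrightarrow> \<not> in_ideal F UNIV"
    then show "\<not> in_ideal L UNIV"
      by (meson in_idealE in_idealI order_refl)
  qed
  then obtain M where M: "\<not> in_ideal M UNIV"
    and max: "\<forall>L. \<not> in_ideal L UNIV \<and> M \<subseteq> L \<longrightarrow> L = M"
    by (elim exE conjE)
  have "in_ideal M (UNIV \<inter> S) \<or> in_ideal M (UNIV - S)" for S
  proof (cases "in_ideal (insert S M) UNIV")
    case True
    then show ?thesis using in_ideal_insert by blast
  next
    case False
    then have "S \<in> M" using max[THEN spec, of "insert S M"] by blast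
    then show ?thesis using in_ideal_Union[of "{S}" M] by simp
  qed
  from unsplit_positive_ultrafilter_base[OF M this] show ?thesis by (rule exI)
qed

section \<open>The case where every positive set splits\<close>

lemma infinite_disjoint_positive_sets:
  assumes "\<not> in_ideal K S"
    and split: "\<And>P. \<not> in_ideal K P \<Longrightarrow> \<exists>T. \<not> in_ideal K (P \<inter> T) \<and> \<not> in_ideal K (P - T)"
  shows "\<exists>P :: nat \<Rightarrow> nat set. (\<forall>k. P k \<subseteq> S \<and> \<not> in_ideal K (P k)) \<and> disjoint_family P"
proof -
  obtain T where T: "\<And>P. \<not> in_ideal K P \<Longrightarrow> \<not> in_ideal K (P \<inter> T P)"
    "\<And>P. \<not> in_ideal K P \<Longrightarrow> \<not> in_ideal K (P - T P)"
    using split by metis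
  define R where "R k = ((\<lambda>P. P - T P) ^^ k) S" for k
  have R_Suc: "R (Suc k) = R k - T (R k)" for k
    by (simp add: R_def)
  have pos: "\<not> in_ideal K (R k)" for k
  proof (induction k)
    case 0
    show ?case using assms(1) by (simp add: R_def)
  next
    case (Suc k)
    then show ?case unfolding R_Suc by (rule T(2))
  qed
  have dec: "R l \<subseteq> R k" if "k \<le> l" for k l
    using that by (induction rule: dec_induct) (auto simp: R_Suc)
  define P where "P k = R k \<inter> T (R k)" for k
  have sub: "P k \<subseteq> S" for k
    using dec[of 0 k] by (auto simp: P_def R_def)
  have P_pos: "\<not> in_ideal K (P k)" for k
    unfolding P_def using pos by (rule T(1))
  have "P k \<inter> P l = {}" if "k < l" for k l
    using dec[of "Suc k" l] that by (auto simp: P_def R_Suc)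
  then have "disjoint_family P"
    unfolding disjoint_family_on_def by (metis Int_commute linorder_neq_iff)
  then show ?thesis using sub P_pos by (intro exI[of _ P] conjI allI)
qed

lemma eventually_different_set_encode:
  assumes "x \<noteq> y"
  shows "\<exists>m. \<forall>n>m. set_encode (x \<inter> {..<n}) \<noteq> set_encode (y \<inter> {..<n})"
proof -
  obtain m where m: "m \<in> x \<longleftrightarrow> m \<notin> y" using assms by blast
  have "x \<inter> {..<n} \<noteq> y \<inter> {..<n}" if "n > m" for n
    using m that by blast
  then show ?thesis by (metis finite_Int finite_lessThan set_encode_eq)
qed

lemma continuum_le_maximal_ideal_independent:
  assumes max: "maximal_ideal_independent I" and inf: "infinite I"
    and split: "\<And>A P. A \<in> I \<Longrightarrow> \<not> in_ideal (I - {A}) P \<Longrightarrow>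
      \<exists>T. \<not> in_ideal (I - {A}) (P \<inter> T) \<and> \<not> in_ideal (I - {A}) (P - T)"
  shows "|UNIV :: nat set set| \<le>o |I|"
proof -
  have indep: "\<not> in_ideal (I - {A}) A" if "A \<in> I" for A
    using max that unfolding maximal_ideal_independent_def ideal_independent_iff by blast
  obtain A :: "nat \<Rightarrow> nat set" where A: "inj A" "range A \<subseteq> I"
    using inf infinite_countable_subset by blast
  have "\<forall>n. \<exists>P. (\<forall>k :: nat. P k \<subseteq> A n \<and> \<not> in_ideal (I - {A n}) (P k)) \<and> disjoint_family P"
  proof
    fix n
    have An: "A n \<in> I" using A(2) by blast
    show "\<exists>P. (\<forall>k :: nat. P k \<subseteq> A n \<and> \<not> in_ideal (I - {A n}) (P k)) \<and> disjoint_family P"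
      by (rule infinite_disjoint_positive_sets[OF indep[OF An] split[OF An]])
  qed
  then obtain P :: "nat \<Rightarrow> nat \<Rightarrow> nat set" where P_sub: "\<And>n k. P n k \<subseteq> A n"
    and P_pos: "\<And>n k. \<not> in_ideal (I - {A n}) (P n k)"
    and P_fam: "\<And>n. disjoint_family (P n)"
    by metis
  have P_disj: "k = l" if "a \<in> P n k" "a \<in> P n l" for a n k l
    using P_fam[of n] that unfolding disjoint_family_on_def by blast
  define c where "c x n = set_encode (x \<inter> {..<n})" for x n
  \<comment> \<open>Removing the earlier \<open>A i\<close> makes the stage of a point of
    \<open>Y x\<close> the least \<open>n\<close> with the point in \<open>A n\<close>.\<close>
  define Y where "Y x = (\<Union>n. P n (c x n) - \<Union>(A ` {..<n}))" for x
  have below: "A ` {..<n} \<subseteq> I - {A n}" for n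
    using A by (auto simp: inj_eq)
  have pos: "\<not> in_ideal I (Y x)" for x
  proof
    assume "in_ideal I (Y x)"
    then obtain X where X: "finite X" "X \<subseteq> I" "Y x \<subseteq>\<^sup>* \<Union>X" by (rule in_idealE)
    have "\<not> range A \<subseteq> X"
      using X(1) A(1) range_inj_infinite finite_subset by blast
    \<comment> \<open>For this \<open>n\<close>, both \<open>X\<close> and the earlier
      \<open>A i\<close> avoid \<open>A n\<close>, so together they would put a positive piece into
      the ideal of \<open>A n\<close>.\<close>
    then obtain n where n: "A n \<notin> X" by blast
    have "P n (c x n) - \<Union>(A ` {..<n} \<union> X) \<subseteq> Y x - \<Union>X" by (auto simp: Y_def)
    then have "P n (c x n) \<subseteq>\<^sup>* \<Union>(A ` {..<n} \<union> X)"
      using X(3) finite_subset unfolding almost_subset_def by blast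
    then have "in_ideal (I - {A n}) (P n (c x n))"
      using below X n by (intro in_idealI[of "A ` {..<n} \<union> X"]) auto
    then show False using P_pos by blast
  qed
  have not_A: "\<not> in_ideal (I - {A n}) (A n - Y x)" for n x
  proof
    assume *: "in_ideal (I - {A n}) (A n - Y x)"
    have "in_ideal (I - {A n}) (A n - Y x \<union> \<Union>(A ` {..<n}))"
      using below * by (intro in_ideal_Un in_ideal_Union) auto
    \<comment> \<open>Any index other than \<open>c x n\<close> would serve. This piece misses stage
      \<open>n\<close> by disjointness and all later stages because they omit
      \<open>A n\<close>.\<close>
    moreover have "P n (Suc (c x n)) \<subseteq> A n - Y x \<union> \<Union>(A ` {..<n})"
    proof
      fix a assume a: "a \<in> P n (Suc (c x n))"
      then have aA: "a \<in> A n" using P_sub by blast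
      show "a \<in> A n - Y x \<union> \<Union>(A ` {..<n})"
      proof (cases "a \<in> Y x")
        case True
        then obtain m where m: "a \<in> P m (c x m)" "\<And>i. i < m \<Longrightarrow> a \<notin> A i"
          by (auto simp: Y_def)
        have "m \<noteq> n" using m(1) a P_disj by (metis n_not_Suc_n)
        moreover have "\<not> n < m" using m(2) aA by blast
        ultimately show ?thesis using m(1) P_sub by (auto simp: nat_neq_iff)
      qed (use aA in blast)
    qed
    ultimately show False using P_pos in_ideal_subset by blast
  qed
  have "\<exists>B\<in>I. in_ideal (I - {B}) (B - Y x)" for x
    using maximal_ideal_independentD[OF max pos] .
  then obtain B where B: "\<And>x. B x \<in> I" "\<And>x. in_ideal (I - {B x}) (B x - Y x)"
    by metis
  \<comment> \<open>A common value would lie in \<open>Y x \<inter> Y y\<close> modulo its own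
    ideal, hence be covered by finitely many \<open>A i\<close>, all different from it by
    \<open>not_A\<close>. This contradicts independence.\<close>
  have "inj B"
  proof (rule injI, rule ccontr)
    fix x y assume eq: "B x = B y" and "x \<noteq> y"
    then obtain m where m: "\<And>n. n > m \<Longrightarrow> c x n \<noteq> c y n"
      using eventually_different_set_encode unfolding c_def by blast
    have meet: "Y x \<inter> Y y \<subseteq> \<Union>(A ` {..m})"
    proof
      fix a assume a: "a \<in> Y x \<inter> Y y"
      then obtain n where n: "a \<in> P n (c x n)" "\<And>i. i < n \<Longrightarrow> a \<notin> A i"
        by (auto simp: Y_def)
      obtain n' where n': "a \<in> P n' (c y n')" "\<And>i. i < n' \<Longrightarrow> a \<notin> A i"
        using a by (auto simp: Y_def)
      have "n = n'" using n n' P_sub by (meson linorder_neqE_nat subsetD)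
      then have "c x n = c y n" using n(1) n'(1) P_disj by blast
      then have "n \<le> m" using m by (meson not_le)
      then show "a \<in> \<Union>(A ` {..m})" using n(1) P_sub by blast
    qed
    have "B x \<noteq> A n" for n
      using B(2)[of x] not_A[of n x] by metis
    then have "A ` {..m} \<subseteq> I - {B x}" using A(2) by fastforce
    then have "in_ideal (I - {B x}) ((B x - Y x) \<union> (B x - Y y) \<union> \<Union>(A ` {..m}))"
      using B(2)[of x] B(2)[of y] eq by (intro in_ideal_Un in_ideal_Union) auto
    then have "in_ideal (I - {B x}) (B x)"
      by (rule in_ideal_subset) (use meet in blast)
    then show False using indep B(1) by blast
  qed
  then show ?thesis using B(1) by (intro card_of_ordLeqI[of B]) auto
qed

section \<open>Comparison of the two cardinals\<close>

lemma ultrafilter_base_le_maximal_ideal_independent: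
  assumes "maximal_ideal_independent I" "infinite I"
  shows "\<exists>B U. ultrafilter U \<and> nonprincipal U \<and> filter_base B U \<and> |B| \<le>o |I|"
proof (cases "\<exists>A\<in>I. \<exists>P. \<not> in_ideal (I - {A}) P \<and>
    (\<forall>S. in_ideal (I - {A}) (P \<inter> S) \<or> in_ideal (I - {A}) (P - S))")
  case True
  then obtain A P where "\<not> in_ideal (I - {A}) P"
    "\<And>S. in_ideal (I - {A}) (P \<inter> S) \<or> in_ideal (I - {A}) (P - S)"
    by blast
  then obtain U where U: "ultrafilter U" "nonprincipal U"
      "filter_base ((\<lambda>X. P - \<Union>X) ` Fpow (I - {A})) U"
    using unsplit_positive_ultrafilter_base by blast
  \<comment> \<open>The base is indexed by finite subfamilies, and an infinite \<open>I\<close> has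
    only \<open>|I|\<close> of these.\<close>
  have "|(\<lambda>X. P - \<Union>X) ` Fpow (I - {A})| \<le>o |Fpow (I - {A})|"
    by (rule card_of_image)
  also have "|Fpow (I - {A})| \<le>o |Fpow I|"
    by (intro card_of_mono1 Fpow_mono) blast
  also have "|Fpow I| =o |I|"
    using assms(2) by (rule card_of_Fpow_infinite)
  finally show ?thesis using U by blast
next
  case False
  have "|UNIV :: nat set set| \<le>o |I|"
    using continuum_le_maximal_ideal_independent[OF assms] False by blast
  then have "|B| \<le>o |I|" for B :: "nat set set"
    using card_of_mono1[OF subset_UNIV] ordLeq_transitive by blast
  then show ?thesis using ex_nonprincipal_ultrafilter_base by blast
qed

theorem mainTheorem1:
  shows "\<uu> \<le>o \<ss>\<^sub>m\<^sub>m"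
proof -
  \<comment> \<open>\<open>least_card\<close> is attained only for a nonempty collection, so
    existence of an infinite maximal family enters here.\<close>
  obtain I where I: "maximal_ideal_independent I" "infinite I" "\<ss>\<^sub>m\<^sub>m = |I|"
    using least_card_attained[of "{I. maximal_ideal_independent I \<and> infinite I}"]
      ex_infinite_maximal_ideal_independent
    unfolding max_ideal_independence_number_def by auto
  let ?S = "{B. \<exists>U. ultrafilter U \<and> nonprincipal U \<and> filter_base B U}"
  obtain B where B: "B \<in> ?S" "|B| \<le>o |I|"
    using ultrafilter_base_le_maximal_ideal_independent[OF I(1,2)] by blast
  then obtain B' where "\<uu> = |B'|" "\<forall>B\<in>?S. |B'| \<le>o |B|"
    using least_card_attained[of ?S] unfolding ultrafilter_number_def by blast
  then have "\<uu> \<le>o |B|" using B(1) by auto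
  then show ?thesis using B(2) ordLeq_transitive unfolding I(3) by blast
qed

end
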